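(* Let $\{(X_i,x_i)\}_{i\in J}$ be a collection of based topological spaces, each path connected and locally path connected, and give $\prod_{i\in J}X_i$ the product topology and the basepoint $(x_i)_{i\in J}$. Let $p_j:\prod_{i\in J}X_i\to X_j$ be the projections. Then the canonical group isomorphism $$\Phi:\pi_1^{wh}\Big(\prod_{i\in J}(X_i,x_i)\Big)\to\prod_{i\in J}\pi_1^{wh}(X_i,x_i),\qquad \Phi([\zeta])=([p_j\circ\zeta])_{j\in J},$$ is a homeomorphism, where the target carries the product topology.
   Context: For a based space $(X,x_0)$, $\pi_1^{wh}(X,x_0)$ denotes the fundamental group $\pi_1(X,x_0)$ with the whisker topology: the topology having as a basis the sets $B([\zeta],U)=\{[\zeta\cdot\eta] : \eta \text{ a loop based at } x_0 \text{ with image contained in } U\}$, where $[\zeta]\in\pi_1(X,x_0)$ and $U$ is an open neighborhood of $x_0$ in $X$. Here $\zeta\cdot\eta$ is path concatenation. *)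

theory Defs
  imports "HOL-Analysis.Analysis" "HOL-Algebra.Product_Groups"
begin

text \<open>
  As for \<^const>\<open>pathin\<close>, a path is a total function on the reals of which only the restriction to
  \<open>{0..1}\<close> matters.
\<close>

definition loops :: "'a topology \<Rightarrow> 'a \<Rightarrow> (real \<Rightarrow> 'a) set"
  where "loops X x0 = {p. pathin X p \<and> p 0 = x0 \<and> p 1 = x0}"

text \<open>
  \<^const>\<open>joinpaths\<close> and \<^const>\<open>homotopic_paths\<close> are restricted to type-class topologies, so their
  definitions are repeated here for spaces of type \<open>'a topology\<close>.
\<close>

definition path_concat :: "(real \<Rightarrow> 'a) \<Rightarrow> (real \<Rightarrow> 'a) \<Rightarrow> real \<Rightarrow> 'a"
  where "path_concat p q = (\<lambda>t. if t \<le> 1/2 then p (2 * t) else q (2 * t - 1))"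

definition loop_homotopic :: "'a topology \<Rightarrow> 'a \<Rightarrow> (real \<Rightarrow> 'a) \<Rightarrow> (real \<Rightarrow> 'a) \<Rightarrow> bool"
  where "loop_homotopic X x0 p q \<longleftrightarrow>
    homotopic_with (\<lambda>r. r 0 = x0 \<and> r 1 = x0) (top_of_set {0..1}) X p q"

definition loop_class :: "'a topology \<Rightarrow> 'a \<Rightarrow> (real \<Rightarrow> 'a) \<Rightarrow> (real \<Rightarrow> 'a) set"
  where "loop_class X x0 p = {q. loop_homotopic X x0 p q}"

text \<open>
  Operations on homotopy classes are defined as unions over all representatives; by invariance
  under homotopy all the sets in such a union coincide.
\<close>

definition fundamental_group :: "'a topology \<Rightarrow> 'a \<Rightarrow> (real \<Rightarrow> 'a) set monoid"
  where "fundamental_group X x0 =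
    \<lparr>carrier = loop_class X x0 ` loops X x0,
     monoid.mult = (\<lambda>a b. \<Union>p\<in>a. \<Union>q\<in>b. loop_class X x0 (path_concat p q)),
     one = loop_class X x0 (\<lambda>t. x0)\<rparr>"

definition whisker_nbhd :: "'a topology \<Rightarrow> 'a \<Rightarrow> (real \<Rightarrow> 'a) \<Rightarrow> 'a set \<Rightarrow> (real \<Rightarrow> 'a) set set"
  where "whisker_nbhd X x0 p U =
    {loop_class X x0 (path_concat p q) | q. q \<in> loops X x0 \<and> q ` {0..1} \<subseteq> U}"

text \<open>
  The generating sets form a basis, since \<open>whisker_nbhd X x0 r (U \<inter> V)\<close> is contained in
  \<open>whisker_nbhd X x0 p U \<inter> whisker_nbhd X x0 q V\<close> whenever the class of \<open>r\<close> lies in the latter,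
  so the topology they generate is the one consisting of their unions.
\<close>

definition whisker_topology :: "'a topology \<Rightarrow> 'a \<Rightarrow> (real \<Rightarrow> 'a) set topology"
  where "whisker_topology X x0 =
    topology_generated_by
      {whisker_nbhd X x0 p U | p U. p \<in> loops X x0 \<and> openin X U \<and> x0 \<in> U}"

definition induced_map ::
    "'b topology \<Rightarrow> 'b \<Rightarrow> ('a \<Rightarrow> 'b) \<Rightarrow> (real \<Rightarrow> 'a) set \<Rightarrow> (real \<Rightarrow> 'b) set"
  where "induced_map Y y0 f a = (\<Union>p\<in>a. loop_class Y y0 (f \<circ> p))"

definition pi1_product_map ::
    "'i set \<Rightarrow> ('i \<Rightarrow> 'a topology) \<Rightarrow> ('i \<Rightarrow> 'a) \<Rightarrow> (real \<Rightarrow> 'i \<Rightarrow> 'a) set \<Rightarrow> 'i \<Rightarrow> (real \<Rightarrow> 'a) set"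
  where "pi1_product_map J X x a = (\<lambda>j\<in>J. induced_map (X j) (x j) (\<lambda>z. z j) a)"

end

theory Submission
  imports Defs
begin

text \<open>
  Paths and homotopies in a product are families of paths and homotopies in the factors, so
  \<open>[\<zeta>] \<mapsto> ([p\<^sub>j \<circ> \<zeta>])\<^sub>j\<close> is a bijection (\<open>pi1_product_map_bij\<close>), and it is multiplicative because
  concatenation is computed coordinatewise. The two continuity statements rest on one fact about
  whiskers: if \<open>[r]\<close> lies in \<open>B([p],U)\<close>, then \<open>B([r],U) \<subseteq> B([p],U)\<close>, so the sets \<open>B([r],U)\<close> with
  \<open>r\<close> fixed form a neighbourhood base at \<open>[r]\<close> (\<open>openin_whisker_topology\<close>).

  For continuity it suffices to treat the coordinates, and a continuous based map always induces a
  continuous map of whisker topologies (\<open>continuous_map_induced_map\<close>). For openness, a neighbourhood of the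
  base point of the product contains a box \<open>\<Prod>\<^sub>j V\<^sub>j\<close> with \<open>V\<^sub>j = X\<^sub>j\<close> for all but finitely many \<open>j\<close>.
  A family of whiskers in the \<open>V\<^sub>j\<close> assembles to a whisker in the box, so the image of
  \<open>B([r], \<Prod>\<^sub>j V\<^sub>j)\<close> contains \<open>\<Prod>\<^sub>j B([p\<^sub>j \<circ> r], V\<^sub>j)\<close> (\<open>box_whisker_subset_image\<close>). The latter is open in
  the product topology even if \<open>J\<close> is infinite, because \<open>B([q], X\<^sub>j)\<close> is the whole group
  (\<open>whisker_nbhd_topspace\<close>): here inverses are used, any class being reached from \<open>[q]\<close> by a
  single whisker that runs back along \<open>q\<close> first.

  The group laws that this needs are all reparametrizations of one loop
  (\<open>loop_homotopic_reparam\<close>).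
\<close>

section \<open>Homotopy of loops\<close>

lemma loops_iff:
  "p \<in> loops X x0 \<longleftrightarrow> continuous_map (top_of_set {0..1}) X p \<and> p 0 = x0 \<and> p 1 = x0"
  by (simp add: loops_def pathin_def)

lemma loops_in_topspace: "\<lbrakk>p \<in> loops X x0; t \<in> {0..1}\<rbrakk> \<Longrightarrow> p t \<in> topspace X"
  by (auto simp: loops_iff continuous_map_def Pi_iff)

text \<open>
  Only the values on the unit interval matter, so a homotopy need not match the loops elsewhere.
\<close>

lemma loop_homotopic_iff:
  "loop_homotopic X x0 p q \<longleftrightarrow>
    (\<exists>h. continuous_map (prod_topology (top_of_set {0..1::real}) (top_of_set {0..1})) X h \<and>
      (\<forall>s\<in>{0..1}. h (0, s) = p s) \<and> (\<forall>s\<in>{0..1}. h (1, s) = q s) \<and>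
      (\<forall>t\<in>{0..1}. h (t, 0) = x0 \<and> h (t, 1) = x0))"
  unfolding loop_homotopic_def by (subst homotopic_with; simp)

lemma loop_homotopic_imp_loops:
  assumes "loop_homotopic X x0 p q"
  shows "p \<in> loops X x0" "q \<in> loops X x0"
  using homotopic_with_imp_continuous_maps homotopic_with_imp_property assms
  unfolding loop_homotopic_def loops_iff by blast+

lemma loop_homotopic_refl: "p \<in> loops X x0 \<Longrightarrow> loop_homotopic X x0 p p"
  by (simp add: loop_homotopic_def loops_iff)

lemma loop_homotopic_sym: "loop_homotopic X x0 p q \<Longrightarrow> loop_homotopic X x0 q p"
  unfolding loop_homotopic_def by (rule homotopic_with_symD)

lemma loop_homotopic_trans:
  "\<lbrakk>loop_homotopic X x0 p q; loop_homotopic X x0 q r\<rbrakk> \<Longrightarrow> loop_homotopic X x0 p r"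
  unfolding loop_homotopic_def by (rule homotopic_with_trans)

lemma loop_class_eqI:
  assumes "loop_homotopic X x0 p q"
  shows "loop_class X x0 p = loop_class X x0 q"
  using loop_homotopic_trans[OF assms] loop_homotopic_trans[OF loop_homotopic_sym[OF assms]]
  unfolding loop_class_def by (intro Collect_cong iffI)

lemma loop_class_eq_iff:
  assumes "p \<in> loops X x0"
  shows "loop_class X x0 p = loop_class X x0 q \<longleftrightarrow> loop_homotopic X x0 p q"
proof
  assume "loop_class X x0 p = loop_class X x0 q"
  moreover have "p \<in> loop_class X x0 p"
    using loop_homotopic_refl[OF assms] by (simp add: loop_class_def)
  ultimately have "p \<in> loop_class X x0 q"
    by simp
  then show "loop_homotopic X x0 p q"
    unfolding loop_class_def mem_Collect_eq by (rule loop_homotopic_sym)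
qed (rule loop_class_eqI)

lemma loop_homotopic_compose:
  assumes "loop_homotopic X x0 p q" "continuous_map X Y f" "f x0 = y0"
  shows "loop_homotopic Y y0 (f \<circ> p) (f \<circ> q)"
  using assms(1,2) unfolding loop_homotopic_def
  by (rule homotopic_with_compose_continuous_map_left) (use assms(3) in auto)

lemma loops_compose:
  "\<lbrakk>p \<in> loops X x0; continuous_map X Y f; f x0 = y0\<rbrakk> \<Longrightarrow> f \<circ> p \<in> loops Y y0"
  by (simp add: loops_iff continuous_map_compose[of _ X p Y f])

text \<open>
  The unit interval is convex, so the straight-line homotopy between two reparametrizations with
  equal endpoints stays in it; composing with \<open>p\<close> gives the homotopy. The reparametrizations need
  not fix the ends of the interval, which is what makes \<open>p\<close> followed by its reverse an instance.
\<close>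

lemma loop_homotopic_reparam:
  assumes p: "p \<in> loops X x0"
    and f: "continuous_on {0..1} f" "f ` {0..1} \<subseteq> {0..1}"
    and g: "continuous_on {0..1} g" "g ` {0..1} \<subseteq> {0..1}"
    and ends: "g 0 = f 0" "g 1 = f 1" "p (f 0) = x0" "p (f 1) = x0"
  shows "loop_homotopic X x0 (p \<circ> f) (p \<circ> g)"
proof -
  define k where "k = (\<lambda>z::real \<times> real. (1 - fst z) * f (snd z) + fst z * g (snd z))"
  have "continuous_on ({0..1} \<times> {0..1}) (\<lambda>z. f (snd z))"
       "continuous_on ({0..1} \<times> {0..1}) (\<lambda>z. g (snd z))"
    by (rule continuous_on_compose2[OF f(1)] continuous_on_compose2[OF g(1)];
        force intro!: continuous_intros)+
  then have "continuous_on ({0..1} \<times> {0..1}) k"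
    unfolding k_def by (intro continuous_intros)
  moreover have "k ` ({0..1} \<times> {0..1}) \<subseteq> {0..1}"
  proof clarify
    fix t s :: real
    assume t: "t \<in> {0..1}" and s: "s \<in> {0..1}"
    then have "f s \<in> {0..1}" "g s \<in> {0..1}" using f(2) g(2) by blast+
    then show "k (t, s) \<in> {0..1}"
      using convexD_alt[of "{0..1::real}" "f s" "g s" t] t by (simp add: k_def)
  qed
  ultimately have "continuous_map (top_of_set ({0..1} \<times> {0..1})) (top_of_set {0..1}) k"
    by (auto simp: continuous_map_in_subtopology)
  then have "continuous_map (prod_topology (top_of_set {0..1}) (top_of_set {0..1})) X (p \<circ> k)"
    using p unfolding loops_iff
    by (metis continuous_map_compose euclidean_product_topology prod_topology_subtopology_eu)
  then show ?thesis
    unfolding loop_homotopic_iff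
    by (intro exI[of _ "p \<circ> k"]) (use ends in \<open>auto simp: k_def algebra_simps\<close>)
qed

section \<open>Concatenation\<close>

lemma path_concat_compose: "f \<circ> path_concat p q = path_concat (f \<circ> p) (f \<circ> q)"
  by (auto simp: path_concat_def fun_eq_iff)

lemma path_concat_image_subset:
  assumes "p ` {0..1} \<subseteq> U" "q ` {0..1} \<subseteq> U"
  shows "path_concat p q ` {0..1} \<subseteq> U"
  using assms by (auto simp: path_concat_def image_subset_iff)

lemma loop_homotopic_path_concat:
  assumes "loop_homotopic X x0 p p'" "loop_homotopic X x0 q q'"
  shows "loop_homotopic X x0 (path_concat p q) (path_concat p' q')"
proof -
  let ?S = "prod_topology (top_of_set {0..1::real}) (top_of_set {0..1::real})"
  obtain h where h: "continuous_map ?S X h" "\<And>s. s \<in> {0..1} \<Longrightarrow> h (0, s) = p s"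
      "\<And>s. s \<in> {0..1} \<Longrightarrow> h (1, s) = p' s"
      "\<And>t. t \<in> {0..1} \<Longrightarrow> h (t, 0) = x0 \<and> h (t, 1) = x0"
    using assms(1) unfolding loop_homotopic_iff by blast
  obtain k where k: "continuous_map ?S X k" "\<And>s. s \<in> {0..1} \<Longrightarrow> k (0, s) = q s"
      "\<And>s. s \<in> {0..1} \<Longrightarrow> k (1, s) = q' s"
      "\<And>t. t \<in> {0..1} \<Longrightarrow> k (t, 0) = x0 \<and> k (t, 1) = x0"
    using assms(2) unfolding loop_homotopic_iff by blast
  have S: "?S = top_of_set ({0..1} \<times> {0..1})"
    by (simp add: prod_topology_subtopology_eu)
  have half: "continuous_map (top_of_set A) ?S f"
    if "continuous_on A f" "f ` A \<subseteq> {0..1} \<times> {0..1}" for A and f :: "real \<times> real \<Rightarrow> real \<times> real"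
    using that by (auto simp: S continuous_map_in_subtopology)
  \<comment> \<open>Both halves have the value \<open>x0\<close> on the common edge, so they paste.\<close>
  define H where "H = (\<lambda>z. if snd z \<le> 1/2 then (h \<circ> (\<lambda>z. (fst z, 2 * snd z))) z
                           else (k \<circ> (\<lambda>z. (fst z, 2 * snd z - 1))) z)"
  have "continuous_map (top_of_set ({0..1} \<times> {0..1})) X H"
    unfolding H_def
  proof (rule continuous_map_cases_le)
    show "continuous_map (subtopology (top_of_set ({0..1} \<times> {0..1}))
        {z \<in> topspace (top_of_set ({0..1} \<times> {0..1})). snd z \<le> 1/2}) X (h \<circ> (\<lambda>z. (fst z, 2 * snd z)))"
      unfolding subtopology_subtopology
      by (rule continuous_map_compose[OF half h(1)]) (auto intro!: continuous_intros)
    show "continuous_map (subtopology (top_of_set ({0..1} \<times> {0..1}))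
        {z \<in> topspace (top_of_set ({0..1} \<times> {0..1})). 1/2 \<le> snd z}) X (k \<circ> (\<lambda>z. (fst z, 2 * snd z - 1)))"
      unfolding subtopology_subtopology
      by (rule continuous_map_compose[OF half k(1)]) (auto intro!: continuous_intros)
    show "(h \<circ> (\<lambda>z. (fst z, 2 * snd z))) z = (k \<circ> (\<lambda>z. (fst z, 2 * snd z - 1))) z"
      if "z \<in> topspace (top_of_set ({0..1} \<times> {0..1}))" "snd z = 1/2" for z
    proof -
      have "2 * snd z = 1" "2 * snd z - 1 = 0" "fst z \<in> {0..1}" using that by auto
      then show ?thesis unfolding o_apply by (simp only: h(4) k(4))
    qed
  qed (auto intro!: continuous_intros)
  then show ?thesis
    unfolding loop_homotopic_iff S[symmetric]
    by (intro exI[of _ H]) (use h k in \<open>auto simp: H_def path_concat_def\<close>)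
qed

lemma path_concat_loops:
  "\<lbrakk>p \<in> loops X x0; q \<in> loops X x0\<rbrakk> \<Longrightarrow> path_concat p q \<in> loops X x0"
  using loop_homotopic_path_concat loop_homotopic_refl loop_homotopic_imp_loops by metis

lemma loop_class_path_concat_cong:
  assumes "loop_class X x0 p = loop_class X x0 p'" "loop_class X x0 q = loop_class X x0 q'"
    "p \<in> loops X x0" "q \<in> loops X x0"
  shows "loop_class X x0 (path_concat p q) = loop_class X x0 (path_concat p' q')"
  using assms by (simp add: loop_class_eq_iff loop_class_eqI loop_homotopic_path_concat)

lemma const_loop:
  "p \<in> loops X x0 \<Longrightarrow> (\<lambda>t. x0) \<in> loops X x0"
  using loops_in_topspace[of p X x0 0] by (auto simp: loops_iff)

lemma loop_class_concat_assoc: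
  assumes "p \<in> loops X x0" "q \<in> loops X x0" "r \<in> loops X x0"
  shows "loop_class X x0 (path_concat (path_concat p q) r) =
         loop_class X x0 (path_concat p (path_concat q r))"
proof -
  let ?w = "path_concat p (path_concat q r)"
  have w: "?w \<in> loops X x0" using assms by (intro path_concat_loops)
  \<comment> \<open>\<open>f\<close> takes the breakpoints 1/4 and 1/2 of \<open>(p \<cdot> q) \<cdot> r\<close> to the breakpoints 1/2 and 3/4 of
    \<open>p \<cdot> (q \<cdot> r)\<close>. The slopes 2, 1 and 1/2 decrease, so it is a minimum of affine functions.\<close>
  define f where "f = (\<lambda>t::real. min (2 * t) (min (t + 1/4) ((t + 1) / 2)))"
  have "loop_homotopic X x0 (?w \<circ> f) (?w \<circ> id)"
    by (rule loop_homotopic_reparam[OF w])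
      (use w in \<open>auto simp: f_def loops_iff min_le_iff_disj intro!: continuous_intros\<close>)
  moreover have "?w \<circ> f = path_concat (path_concat p q) r"
  proof
    fix t :: real
    have "f t = (if t \<le> 1/4 then 2 * t else if t \<le> 1/2 then t + 1/4 else (t + 1) / 2)"
      by (simp add: f_def min_def)
    then show "(?w \<circ> f) t = path_concat (path_concat p q) r t"
      by (auto simp: path_concat_def algebra_simps add_divide_distrib)
  qed
  ultimately show ?thesis by (simp add: loop_class_eqI)
qed

lemma loop_class_concat_const_right:
  assumes p: "p \<in> loops X x0"
  shows "loop_class X x0 (path_concat p (\<lambda>t. x0)) = loop_class X x0 p"
proof -
  have "loop_homotopic X x0 (p \<circ> (\<lambda>t. min (2 * t) 1)) (p \<circ> id)"
    by (rule loop_homotopic_reparam[OF p]) (use p in \<open>auto simp: loops_iff intro!: continuous_intros\<close>)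
  moreover have "p \<circ> (\<lambda>t. min (2 * t) 1) = path_concat p (\<lambda>t. x0)"
    using p by (auto simp: fun_eq_iff path_concat_def min_def loops_iff)
  ultimately show ?thesis by (simp add: loop_class_eqI)
qed

lemma loop_class_concat_const_left:
  assumes p: "p \<in> loops X x0"
  shows "loop_class X x0 (path_concat (\<lambda>t. x0) p) = loop_class X x0 p"
proof -
  have "loop_homotopic X x0 (p \<circ> (\<lambda>t. max 0 (2 * t - 1))) (p \<circ> id)"
    by (rule loop_homotopic_reparam[OF p]) (use p in \<open>auto simp: loops_iff intro!: continuous_intros\<close>)
  moreover have "p \<circ> (\<lambda>t. max 0 (2 * t - 1)) = path_concat (\<lambda>t. x0) p"
    using p by (auto simp: fun_eq_iff path_concat_def max_absorb1 max_absorb2 loops_iff)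
  ultimately show ?thesis by (simp add: loop_class_eqI)
qed

lemma reversed_loop:
  assumes p: "p \<in> loops X x0"
  shows "(\<lambda>t. p (1 - t)) \<in> loops X x0"
proof -
  have "continuous_map (top_of_set {0..1::real}) (top_of_set {0..1}) (\<lambda>t. 1 - t)"
    by (auto simp: continuous_map_in_subtopology intro!: continuous_intros)
  then have "continuous_map (top_of_set {0..1}) X (p \<circ> (\<lambda>t. 1 - t))"
    by (rule continuous_map_compose) (use p in \<open>simp add: loops_iff\<close>)
  then show ?thesis
    using p by (simp add: loops_iff o_def)
qed

lemma loop_class_concat_reversed:
  assumes p: "p \<in> loops X x0"
  shows "loop_class X x0 (path_concat p (\<lambda>t. p (1 - t))) = loop_class X x0 (\<lambda>t. x0)"
proof -
  have "loop_homotopic X x0 (p \<circ> (\<lambda>t. min (2 * t) (2 - 2 * t))) (p \<circ> (\<lambda>t. 0))"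
    by (rule loop_homotopic_reparam[OF p]) (use p in \<open>auto simp: loops_iff intro!: continuous_intros\<close>)
  moreover have "p \<circ> (\<lambda>t. min (2 * t) (2 - 2 * t)) = path_concat p (\<lambda>t. p (1 - t))"
  proof
    fix t :: real
    have "min (2 * t) (2 - 2 * t) = (if t \<le> 1/2 then 2 * t else 1 - (2 * t - 1))"
      by (simp add: min_def)
    then show "(p \<circ> (\<lambda>t. min (2 * t) (2 - 2 * t))) t = path_concat p (\<lambda>t. p (1 - t)) t"
      by (simp add: path_concat_def)
  qed
  moreover have "p \<circ> (\<lambda>t::real. 0) = (\<lambda>t. x0)"
    using p by (simp add: loops_iff o_def)
  ultimately have "loop_homotopic X x0 (path_concat p (\<lambda>t. p (1 - t))) (\<lambda>t. x0)"
    by (simp only:)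
  then show ?thesis by (rule loop_class_eqI)
qed

text \<open>The loop \<open>r\<close> runs back along \<open>p\<close> and then along \<open>q\<close>.\<close>

lemma loop_class_factor:
  assumes p: "p \<in> loops X x0" and q: "q \<in> loops X x0"
  obtains r where "r \<in> loops X x0" "loop_class X x0 (path_concat p r) = loop_class X x0 q"
proof
  let ?i = "\<lambda>t. p (1 - t)"
  have i: "?i \<in> loops X x0" by (rule reversed_loop[OF p])
  show "path_concat ?i q \<in> loops X x0" by (rule path_concat_loops[OF i q])
  have "loop_class X x0 (path_concat p (path_concat ?i q)) =
        loop_class X x0 (path_concat (path_concat p ?i) q)"
    by (rule loop_class_concat_assoc[OF p i q, symmetric])
  also have "\<dots> = loop_class X x0 (path_concat (\<lambda>t. x0) q)"
    by (intro loop_class_path_concat_cong loop_class_concat_reversed path_concat_loops p q i refl)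
  also have "\<dots> = loop_class X x0 q"
    by (rule loop_class_concat_const_left[OF q])
  finally show "loop_class X x0 (path_concat p (path_concat ?i q)) = loop_class X x0 q" .
qed

section \<open>Operations on homotopy classes\<close>

lemma mem_loop_class_self: "p \<in> loops X x0 \<Longrightarrow> p \<in> loop_class X x0 p"
  by (simp add: loop_class_def loop_homotopic_refl)

lemma carrier_fundamental_group [simp]:
  "carrier (fundamental_group X x0) = loop_class X x0 ` loops X x0"
  by (simp add: fundamental_group_def)

text \<open>
  All representatives contribute the same class to the union, and there is at least one.
\<close>

lemma mult_loop_class:
  assumes "p \<in> loops X x0" "q \<in> loops X x0"
  shows "loop_class X x0 p \<otimes>\<^bsub>fundamental_group X x0\<^esub> loop_class X x0 q =
         loop_class X x0 (path_concat p q)"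
proof -
  have "loop_class X x0 (path_concat p q) = loop_class X x0 (path_concat p' q')"
    if "p' \<in> loop_class X x0 p" "q' \<in> loop_class X x0 q" for p' q'
    using that unfolding loop_class_def[of X x0 p] loop_class_def[of X x0 q] mem_Collect_eq
    by (intro loop_class_eqI loop_homotopic_path_concat)
  then have "(\<Union>p'\<in>loop_class X x0 p. \<Union>q'\<in>loop_class X x0 q. loop_class X x0 (path_concat p' q')) =
      (\<Union>p'\<in>loop_class X x0 p. \<Union>q'\<in>loop_class X x0 q. loop_class X x0 (path_concat p q))"
    by simp
  then show ?thesis
    using mem_loop_class_self[OF assms(1)] mem_loop_class_self[OF assms(2)]
    by (auto simp: fundamental_group_def)
qed

lemma induced_map_loop_class:
  assumes f: "continuous_map X Y f" "f x0 = y0" and p: "p \<in> loops X x0"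
  shows "induced_map Y y0 f (loop_class X x0 p) = loop_class Y y0 (f \<circ> p)"
proof -
  have "loop_class Y y0 (f \<circ> p) = loop_class Y y0 (f \<circ> q)" if "q \<in> loop_class X x0 p" for q
    using that f unfolding loop_class_def[of X x0 p] mem_Collect_eq
    by (intro loop_class_eqI loop_homotopic_compose)
  then have "induced_map Y y0 f (loop_class X x0 p) = (\<Union>q\<in>loop_class X x0 p. loop_class Y y0 (f \<circ> p))"
    unfolding induced_map_def by simp
  then show ?thesis
    using mem_loop_class_self[OF p] by auto
qed

section \<open>The whisker topology\<close>

lemma whisker_nbhd_subset_carrier:
  "p \<in> loops X x0 \<Longrightarrow> whisker_nbhd X x0 p U \<subseteq> loop_class X x0 ` loops X x0"
  by (auto simp: whisker_nbhd_def path_concat_loops)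

lemma whisker_nbhdI:
  "\<lbrakk>q \<in> loops X x0; q ` {0..1} \<subseteq> U; a = loop_class X x0 (path_concat p q)\<rbrakk>
    \<Longrightarrow> a \<in> whisker_nbhd X x0 p U"
  by (auto simp: whisker_nbhd_def)

lemma whisker_nbhd_mono: "U \<subseteq> V \<Longrightarrow> whisker_nbhd X x0 p U \<subseteq> whisker_nbhd X x0 p V"
  by (auto simp: whisker_nbhd_def)

lemma whisker_nbhd_self:
  assumes "p \<in> loops X x0" "x0 \<in> U"
  shows "loop_class X x0 p \<in> whisker_nbhd X x0 p U"
  by (rule whisker_nbhdI[OF const_loop[OF assms(1)]])
    (use assms(2) in \<open>auto simp: loop_class_concat_const_right[OF assms(1)]\<close>)

text \<open>
  Associativity makes any class in a basic set a possible centre: whiskers in \<open>U\<close> can be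
  concatenated without leaving \<open>U\<close>.
\<close>

lemma whisker_nbhd_recentre:
  assumes p: "p \<in> loops X x0" and r: "r \<in> loops X x0"
    and "loop_class X x0 r \<in> whisker_nbhd X x0 p U"
  shows "whisker_nbhd X x0 r U \<subseteq> whisker_nbhd X x0 p U"
proof
  fix a
  assume "a \<in> whisker_nbhd X x0 r U"
  then obtain s where s: "s \<in> loops X x0" "s ` {0..1} \<subseteq> U" "a = loop_class X x0 (path_concat r s)"
    by (auto simp: whisker_nbhd_def)
  obtain q where q: "q \<in> loops X x0" "q ` {0..1} \<subseteq> U"
      "loop_class X x0 r = loop_class X x0 (path_concat p q)"
    using assms(3) by (auto simp: whisker_nbhd_def)
  have "a = loop_class X x0 (path_concat (path_concat p q) s)"
    unfolding s(3) by (intro loop_class_path_concat_cong q(3) r s(1) refl)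
  also have "\<dots> = loop_class X x0 (path_concat p (path_concat q s))"
    by (rule loop_class_concat_assoc[OF p q(1) s(1)])
  finally show "a \<in> whisker_nbhd X x0 p U"
    by (rule whisker_nbhdI[OF path_concat_loops[OF q(1) s(1)] path_concat_image_subset[OF q(2) s(2)]])
qed

text \<open>
  Whiskers of unrestricted size reach every class. This is why boxes of basic sets are open in an
  infinite product.
\<close>

lemma whisker_nbhd_topspace:
  assumes p: "p \<in> loops X x0"
  shows "whisker_nbhd X x0 p (topspace X) = loop_class X x0 ` loops X x0"
proof
  show "loop_class X x0 ` loops X x0 \<subseteq> whisker_nbhd X x0 p (topspace X)"
  proof clarify
    fix q
    assume "q \<in> loops X x0"
    then obtain r where r: "r \<in> loops X x0" "loop_class X x0 (path_concat p r) = loop_class X x0 q"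
      by (rule loop_class_factor[OF p])
    show "loop_class X x0 q \<in> whisker_nbhd X x0 p (topspace X)"
      by (rule whisker_nbhdI[OF r(1) _ r(2)[symmetric]])
        (use loops_in_topspace[OF r(1)] in blast)
  qed
qed (rule whisker_nbhd_subset_carrier[OF p])

lemma topspace_whisker_topology [simp]:
  "topspace (whisker_topology X x0) = loop_class X x0 ` loops X x0"
proof
  show "topspace (whisker_topology X x0) \<subseteq> loop_class X x0 ` loops X x0"
    unfolding whisker_topology_def topology_generated_by_topspace
    using whisker_nbhd_subset_carrier[of _ X x0] by blast
  show "loop_class X x0 ` loops X x0 \<subseteq> topspace (whisker_topology X x0)"
  proof clarify
    fix p
    assume p: "p \<in> loops X x0"
    then have "x0 \<in> topspace X"
      using loops_in_topspace[of p X x0 0] by (simp add: loops_iff)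
    then show "loop_class X x0 p \<in> topspace (whisker_topology X x0)"
      using whisker_nbhd_topspace[OF p] p unfolding whisker_topology_def topology_generated_by_topspace
      by (intro UnionI[of "whisker_nbhd X x0 p (topspace X)"]) auto
  qed
qed

lemma openin_whisker_nbhd:
  "\<lbrakk>p \<in> loops X x0; openin X U; x0 \<in> U\<rbrakk> \<Longrightarrow> openin (whisker_topology X x0) (whisker_nbhd X x0 p U)"
  unfolding whisker_topology_def by (rule topology_generated_by_Basis) blast

text \<open>
  A neighbourhood criterion that quantifies over representatives: one may always take a basic set
  centred at the given class. Finite intersections are harmless because basic sets with the same
  centre intersect in a set containing \<open>whisker_nbhd X x0 r (U \<inter> U')\<close>.
\<close>

lemma openin_whisker_topology:
  "openin (whisker_topology X x0) W \<longleftrightarrow>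
    W \<subseteq> loop_class X x0 ` loops X x0 \<and>
    (\<forall>r\<in>loops X x0. loop_class X x0 r \<in> W \<longrightarrow>
       (\<exists>U. openin X U \<and> x0 \<in> U \<and> whisker_nbhd X x0 r U \<subseteq> W))"
  (is "_ \<longleftrightarrow> ?sub W \<and> (\<forall>r\<in>_. _ \<longrightarrow> ?nbhd r W)")
proof (intro iffI conjI ballI impI)
  assume W: "openin (whisker_topology X x0) W"
  show "?sub W"
    using openin_subset[OF W] by simp
  fix r
  assume r: "r \<in> loops X x0"
  have "generate_topology_on
          {whisker_nbhd X x0 p U | p U. p \<in> loops X x0 \<and> openin X U \<and> x0 \<in> U} W"
    using W unfolding whisker_topology_def by (rule openin_topology_generated_by)
  then show "loop_class X x0 r \<in> W \<Longrightarrow> ?nbhd r W"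
  proof induction
    case (Int V V')
    then obtain U U' where U: "openin X U" "x0 \<in> U" "whisker_nbhd X x0 r U \<subseteq> V"
      "openin X U'" "x0 \<in> U'" "whisker_nbhd X x0 r U' \<subseteq> V'"
      by auto
    have "whisker_nbhd X x0 r (U \<inter> U') \<subseteq> V \<inter> V'"
      using U(3,6) whisker_nbhd_mono[of "U \<inter> U'" U X x0 r] whisker_nbhd_mono[of "U \<inter> U'" U' X x0 r]
      by blast
    then show ?case
      using U(1,2,4,5) by (intro exI[of _ "U \<inter> U'"]) auto
  next
    case (UN K)
    then obtain V where "V \<in> K" "loop_class X x0 r \<in> V" by blast
    with UN.IH obtain U where "openin X U" "x0 \<in> U" "whisker_nbhd X x0 r U \<subseteq> V" by blast
    with \<open>V \<in> K\<close> show ?case by blast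
  next
    case (Basis V)
    then obtain p U where p: "V = whisker_nbhd X x0 p U" "p \<in> loops X x0"
      and U: "openin X U" "x0 \<in> U" by blast
    have "whisker_nbhd X x0 r U \<subseteq> V"
      using whisker_nbhd_recentre[OF p(2) r] Basis.prems unfolding p(1) .
    with U show ?case by blast
  qed simp
next
  assume *: "?sub W \<and> (\<forall>r\<in>loops X x0. loop_class X x0 r \<in> W \<longrightarrow> ?nbhd r W)"
  show "openin (whisker_topology X x0) W"
  proof (subst openin_subopen, intro ballI)
    fix a
    assume "a \<in> W"
    then obtain r where r: "r \<in> loops X x0" "a = loop_class X x0 r" using * by blast
    have "?nbhd r W"
      using * \<open>a \<in> W\<close> r by simp
    then obtain U where U: "openin X U" "x0 \<in> U" "whisker_nbhd X x0 r U \<subseteq> W"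
      by (elim exE conjE)
    then show "\<exists>T. openin (whisker_topology X x0) T \<and> a \<in> T \<and> T \<subseteq> W"
      using r(2) openin_whisker_nbhd[OF r(1) U(1,2)] whisker_nbhd_self[OF r(1) U(2)]
      by (intro exI[of _ "whisker_nbhd X x0 r U"]) simp
  qed
qed

lemma openin_whisker_topologyE:
  assumes "openin (whisker_topology X x0) W" "r \<in> loops X x0" "loop_class X x0 r \<in> W"
  obtains U where "openin X U" "x0 \<in> U" "whisker_nbhd X x0 r U \<subseteq> W"
  using assms unfolding openin_whisker_topology by blast

text \<open>
  If \<open>[f \<circ> r]\<close> lies in \<open>W\<close> together with its whiskers in \<open>U\<close>, then whiskers at \<open>r\<close> in the preimage of
  \<open>U\<close> are mapped into \<open>W\<close>.
\<close>

lemma continuous_map_induced_map: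
  assumes f: "continuous_map X Y f" "f x0 = y0"
  shows "continuous_map (whisker_topology X x0) (whisker_topology Y y0) (induced_map Y y0 f)"
  unfolding continuous_map_def
proof (intro conjI allI impI)
  show "induced_map Y y0 f \<in> topspace (whisker_topology X x0) \<rightarrow> topspace (whisker_topology Y y0)"
    using induced_map_loop_class[OF f] loops_compose[OF _ f] by auto
  fix W
  assume W: "openin (whisker_topology Y y0) W"
  show "openin (whisker_topology X x0)
         {a \<in> topspace (whisker_topology X x0). induced_map Y y0 f a \<in> W}"
    unfolding openin_whisker_topology[of X]
  proof (intro conjI ballI impI)
    fix r
    assume r: "r \<in> loops X x0"
      and "loop_class X x0 r \<in> {a \<in> topspace (whisker_topology X x0). induced_map Y y0 f a \<in> W}"
    then have "loop_class Y y0 (f \<circ> r) \<in> W"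
      by (simp add: induced_map_loop_class[OF f])
    then obtain U where U: "openin Y U" "y0 \<in> U" "whisker_nbhd Y y0 (f \<circ> r) U \<subseteq> W"
      by (rule openin_whisker_topologyE[OF W loops_compose[OF r f]])
    let ?V = "{z \<in> topspace X. f z \<in> U}"
    have V: "openin X ?V"
      using f(1) U(1) by (rule openin_continuous_map_preimage)
    have x0: "x0 \<in> ?V"
      using loops_in_topspace[OF r, of 0] r U(2) f(2) by (simp add: loops_iff)
    have mem: "induced_map Y y0 f (loop_class X x0 (path_concat r q)) \<in> W"
      if q: "q \<in> loops X x0" "q ` {0..1} \<subseteq> ?V" for q
    proof -
      have "(f \<circ> q) ` {0..1} \<subseteq> U" using q(2) by auto
      then have "loop_class Y y0 (path_concat (f \<circ> r) (f \<circ> q)) \<in> whisker_nbhd Y y0 (f \<circ> r) U"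
        by (rule whisker_nbhdI[OF loops_compose[OF q(1) f] _ refl])
      then have "loop_class Y y0 (path_concat (f \<circ> r) (f \<circ> q)) \<in> W"
        using U(3) by (rule set_mp[rotated])
      then show ?thesis
        using induced_map_loop_class[OF f path_concat_loops[OF r q(1)]]
        by (simp add: path_concat_compose)
    qed
    have "whisker_nbhd X x0 r ?V
        \<subseteq> {a \<in> topspace (whisker_topology X x0). induced_map Y y0 f a \<in> W}"
    proof (intro subsetI CollectI conjI)
      fix a
      assume a: "a \<in> whisker_nbhd X x0 r ?V"
      then show "a \<in> topspace (whisker_topology X x0)"
        using whisker_nbhd_subset_carrier[OF r] by auto
      show "induced_map Y y0 f a \<in> W"
        using a mem unfolding whisker_nbhd_def by blast
    qed
    with V x0 show "\<exists>V. openin X V \<and> x0 \<in> V \<and> whisker_nbhd X x0 r V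
        \<subseteq> {a \<in> topspace (whisker_topology X x0). induced_map Y y0 f a \<in> W}"
      by (intro exI[of _ ?V] conjI)
  qed auto
qed

section \<open>Loops in a product\<close>

lemma tuple_loops:
  assumes "\<And>j. j \<in> J \<Longrightarrow> q j \<in> loops (X j) (x j)"
  shows "(\<lambda>t. \<lambda>j\<in>J. q j t) \<in> loops (product_topology X J) (\<lambda>j\<in>J. x j)"
  using assms by (auto simp: loops_iff continuous_map_componentwise)

lemma coordinate_tuple: "j \<in> J \<Longrightarrow> (\<lambda>z. z j) \<circ> (\<lambda>t. \<lambda>j\<in>J. q j t) = q j"
  by auto

lemma coordinate_loops:
  assumes "p \<in> loops (product_topology X J) (\<lambda>j\<in>J. x j)" "j \<in> J"
  shows "(\<lambda>z. z j) \<circ> p \<in> loops (X j) (x j)"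
  by (rule loops_compose[OF assms(1)]) (use assms(2) in auto)

lemma pi1_product_map_loop_class:
  assumes "p \<in> loops (product_topology X J) (\<lambda>j\<in>J. x j)"
  shows "pi1_product_map J X x (loop_class (product_topology X J) (\<lambda>j\<in>J. x j) p) =
         (\<lambda>j\<in>J. loop_class (X j) (x j) ((\<lambda>z. z j) \<circ> p))"
  unfolding pi1_product_map_def
  by (intro restrict_ext induced_map_loop_class) (use assms in auto)

text \<open>
  Homotopies chosen in the coordinates form a homotopy in the product. Points of the product are
  extensional on \<open>J\<close>, so its ends are \<open>p\<close> and \<open>q\<close> themselves.
\<close>

lemma loop_homotopic_product:
  assumes p: "p \<in> loops (product_topology X J) (\<lambda>j\<in>J. x j)"
    and q: "q \<in> loops (product_topology X J) (\<lambda>j\<in>J. x j)"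
    and "\<And>j. j \<in> J \<Longrightarrow> loop_homotopic (X j) (x j) ((\<lambda>z. z j) \<circ> p) ((\<lambda>z. z j) \<circ> q)"
  shows "loop_homotopic (product_topology X J) (\<lambda>j\<in>J. x j) p q"
proof -
  obtain h where h: "\<And>j. j \<in> J \<Longrightarrow>
      continuous_map (prod_topology (top_of_set {0..1::real}) (top_of_set {0..1})) (X j) (h j) \<and>
      (\<forall>s\<in>{0..1}. h j (0, s) = p s j) \<and> (\<forall>s\<in>{0..1}. h j (1, s) = q s j) \<and>
      (\<forall>t\<in>{0..1}. h j (t, 0) = x j \<and> h j (t, 1) = x j)"
    using assms(3) unfolding loop_homotopic_iff o_def by metis
  have ext: "p s \<in> extensional J" "q s \<in> extensional J" if "s \<in> {0..1}" for s
    using loops_in_topspace[OF p that] loops_in_topspace[OF q that] by (auto simp: PiE_iff)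
  show ?thesis
    unfolding loop_homotopic_iff
  proof (intro exI conjI ballI)
    show "continuous_map (prod_topology (top_of_set {0..1}) (top_of_set {0..1}))
            (product_topology X J) (\<lambda>z. \<lambda>j\<in>J. h j z)"
      using h by (auto simp: continuous_map_componentwise)
    show "(\<lambda>j\<in>J. h j (0, s)) = p s" "(\<lambda>j\<in>J. h j (1, s)) = q s" if "s \<in> {0..1}" for s
      using h that by (auto intro!: extensionalityI[OF restrict_extensional] ext)
  qed (use h in \<open>auto simp: restrict_def\<close>)
qed

lemma pi1_product_map_bij:
  "bij_betw (pi1_product_map J X x)
    (loop_class (product_topology X J) (\<lambda>j\<in>J. x j) ` loops (product_topology X J) (\<lambda>j\<in>J. x j))
    (\<Pi>\<^sub>E j\<in>J. loop_class (X j) (x j) ` loops (X j) (x j))"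
  (is "bij_betw ?\<Phi> (?c ` ?L) ?R")
proof (rule bij_betw_imageI)
  show "inj_on ?\<Phi> (?c ` ?L)"
  proof (rule inj_onI, clarify)
    fix p q
    assume p: "p \<in> ?L" and q: "q \<in> ?L" and "?\<Phi> (?c p) = ?\<Phi> (?c q)"
    then have *: "(\<lambda>j\<in>J. loop_class (X j) (x j) ((\<lambda>z. z j) \<circ> p)) =
        (\<lambda>j\<in>J. loop_class (X j) (x j) ((\<lambda>z. z j) \<circ> q))"
      by (simp add: pi1_product_map_loop_class)
    have "loop_homotopic (X j) (x j) ((\<lambda>z. z j) \<circ> p) ((\<lambda>z. z j) \<circ> q)" if "j \<in> J" for j
      using fun_cong[OF *, of j] that loop_class_eq_iff[OF coordinate_loops[OF p that]] by simp
    then show "?c p = ?c q"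
      by (intro loop_class_eqI loop_homotopic_product[OF p q])
  qed
  show "?\<Phi> ` ?c ` ?L = ?R"
  proof
    show "?\<Phi> ` ?c ` ?L \<subseteq> ?R"
      by (auto simp: pi1_product_map_loop_class coordinate_loops)
    show "?R \<subseteq> ?\<Phi> ` ?c ` ?L"
    proof
      fix a
      assume a: "a \<in> ?R"
      then obtain q where q: "\<And>j. j \<in> J \<Longrightarrow> q j \<in> loops (X j) (x j) \<and> a j = loop_class (X j) (x j) (q j)"
        unfolding PiE_iff image_iff by metis
      have t: "(\<lambda>t. \<lambda>j\<in>J. q j t) \<in> ?L" using q by (intro tuple_loops) auto
      have "?\<Phi> (?c (\<lambda>t. \<lambda>j\<in>J. q j t)) = a"
        unfolding pi1_product_map_loop_class[OF t] using a q
        by (intro extensionalityI[OF restrict_extensional]) (auto simp: PiE_iff coordinate_tuple)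
      then show "a \<in> ?\<Phi> ` ?c ` ?L" using t by blast
    qed
  qed
qed

lemma pi1_product_map_iso:
  "pi1_product_map J X x \<in>
    iso (fundamental_group (product_topology X J) (\<lambda>j\<in>J. x j))
        (product_group J (\<lambda>j. fundamental_group (X j) (x j)))"
proof (rule isoI)
  let ?P = "product_topology X J" and ?b = "\<lambda>j\<in>J. x j"
  show "pi1_product_map J X x \<in> hom (fundamental_group ?P ?b)
      (product_group J (\<lambda>j. fundamental_group (X j) (x j)))"
  proof (rule homI)
    fix a
    assume "a \<in> carrier (fundamental_group ?P ?b)"
    then show "pi1_product_map J X x a \<in> carrier (product_group J (\<lambda>j. fundamental_group (X j) (x j)))"
      using bij_betw_apply[OF pi1_product_map_bij]
      by (simp only: carrier_fundamental_group carrier_product_group)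
  next
    fix a c
    assume "a \<in> carrier (fundamental_group ?P ?b)" "c \<in> carrier (fundamental_group ?P ?b)"
    then obtain p q where p: "p \<in> loops ?P ?b" "a = loop_class ?P ?b p"
      and q: "q \<in> loops ?P ?b" "c = loop_class ?P ?b q"
      by auto
    show "pi1_product_map J X x (a \<otimes>\<^bsub>fundamental_group ?P ?b\<^esub> c) =
        pi1_product_map J X x a \<otimes>\<^bsub>product_group J (\<lambda>j. fundamental_group (X j) (x j))\<^esub>
        pi1_product_map J X x c"
      using p q
      by (auto simp: mult_loop_class pi1_product_map_loop_class path_concat_loops
          path_concat_compose coordinate_loops intro!: restrict_ext)
  qed
  show "bij_betw (pi1_product_map J X x) (carrier (fundamental_group ?P ?b))
      (carrier (product_group J (\<lambda>j. fundamental_group (X j) (x j))))"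
    using pi1_product_map_bij by simp
qed

section \<open>The homeomorphism\<close>

lemma continuous_map_pi1_product_map:
  "continuous_map (whisker_topology (product_topology X J) (\<lambda>j\<in>J. x j))
     (product_topology (\<lambda>j. whisker_topology (X j) (x j)) J) (pi1_product_map J X x)"
proof -
  have "continuous_map (whisker_topology (product_topology X J) (\<lambda>j\<in>J. x j))
      (whisker_topology (X j) (x j)) (induced_map (X j) (x j) (\<lambda>z. z j))" if "j \<in> J" for j
    using that by (intro continuous_map_induced_map) auto
  then show ?thesis
    unfolding pi1_product_map_def by (auto simp: continuous_map_componentwise)
qed

text \<open>
  Whiskers chosen in the coordinates are the coordinates of a single whisker in the box.
\<close>

lemma box_whisker_subset_image:
  assumes r: "r \<in> loops (product_topology X J) (\<lambda>j\<in>J. x j)"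
  shows "(\<Pi>\<^sub>E j\<in>J. whisker_nbhd (X j) (x j) ((\<lambda>z. z j) \<circ> r) (U j)) \<subseteq>
    pi1_product_map J X x ` whisker_nbhd (product_topology X J) (\<lambda>j\<in>J. x j) r (\<Pi>\<^sub>E j\<in>J. U j)"
proof
  let ?P = "product_topology X J" and ?b = "\<lambda>j\<in>J. x j"
  fix a
  assume a: "a \<in> (\<Pi>\<^sub>E j\<in>J. whisker_nbhd (X j) (x j) ((\<lambda>z. z j) \<circ> r) (U j))"
  then have "\<forall>j\<in>J. \<exists>q. q \<in> loops (X j) (x j) \<and> q ` {0..1} \<subseteq> U j \<and>
      a j = loop_class (X j) (x j) (path_concat ((\<lambda>z. z j) \<circ> r) q)"
    by (fastforce simp: PiE_iff whisker_nbhd_def)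
  then obtain q where q: "\<And>j. j \<in> J \<Longrightarrow> q j \<in> loops (X j) (x j) \<and> q j ` {0..1} \<subseteq> U j \<and>
      a j = loop_class (X j) (x j) (path_concat ((\<lambda>z. z j) \<circ> r) (q j))"
    by metis
  let ?t = "\<lambda>t. \<lambda>j\<in>J. q j t"
  have t: "?t \<in> loops ?P ?b" using q by (intro tuple_loops) auto
  have "?t ` {0..1} \<subseteq> (\<Pi>\<^sub>E j\<in>J. U j)" using q by fastforce
  then have "loop_class ?P ?b (path_concat r ?t) \<in> whisker_nbhd ?P ?b r (\<Pi>\<^sub>E j\<in>J. U j)"
    by (rule whisker_nbhdI[OF t _ refl])
  moreover have "pi1_product_map J X x (loop_class ?P ?b (path_concat r ?t)) = a"
    unfolding pi1_product_map_loop_class[OF path_concat_loops[OF r t]] using a q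
    by (intro extensionalityI[OF restrict_extensional])
      (auto simp: PiE_iff path_concat_compose coordinate_tuple)
  ultimately show "a \<in> pi1_product_map J X x ` whisker_nbhd ?P ?b r (\<Pi>\<^sub>E j\<in>J. U j)"
    by blast
qed

lemma open_map_pi1_product_map:
  "open_map (whisker_topology (product_topology X J) (\<lambda>j\<in>J. x j))
     (product_topology (\<lambda>j. whisker_topology (X j) (x j)) J) (pi1_product_map J X x)"
  unfolding open_map_def
proof (intro allI impI)
  let ?P = "product_topology X J" and ?b = "\<lambda>j\<in>J. x j"
    and ?Q = "product_topology (\<lambda>j. whisker_topology (X j) (x j)) J"
  fix W
  assume W: "openin (whisker_topology ?P ?b) W"
  show "openin ?Q (pi1_product_map J X x ` W)"
  proof (subst openin_subopen, clarify)
    fix a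
    assume "a \<in> W"
    then obtain r where r: "r \<in> loops ?P ?b" "a = loop_class ?P ?b r"
      using W unfolding openin_whisker_topology by blast
    with \<open>a \<in> W\<close> have "loop_class ?P ?b r \<in> W"
      by simp
    then obtain U where U: "openin ?P U" "?b \<in> U" "whisker_nbhd ?P ?b r U \<subseteq> W"
      by (rule openin_whisker_topologyE[OF W r(1)])
    obtain V where V: "?b \<in> (\<Pi>\<^sub>E j\<in>J. V j)" "\<And>j. openin (X j) (V j)"
      "finite {j. V j \<noteq> topspace (X j)}" "(\<Pi>\<^sub>E j\<in>J. V j) \<subseteq> U"
      using product_topology_open_contains_basis[OF U(1,2)] by metis
    let ?N = "\<lambda>j. whisker_nbhd (X j) (x j) ((\<lambda>z. z j) \<circ> r) (V j)"
    have x: "x j \<in> V j" if "j \<in> J" for j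
      using V(1) that by (auto simp: PiE_iff)
    \<comment> \<open>All but finitely many factors of the box of basic sets are whole groups, so it is open.\<close>
    have "?N j = topspace (whisker_topology (X j) (x j))" if "j \<in> J" "V j = topspace (X j)" for j
      using whisker_nbhd_topspace[OF coordinate_loops[OF r(1)]] that by simp
    then have "{j \<in> J. ?N j \<noteq> topspace (whisker_topology (X j) (x j))} \<subseteq> {j. V j \<noteq> topspace (X j)}"
      by blast
    then have "finite {j \<in> J. ?N j \<noteq> topspace (whisker_topology (X j) (x j))}"
      using V(3) by (rule finite_subset)
    moreover have "openin (whisker_topology (X j) (x j)) (?N j)" if "j \<in> J" for j
      using openin_whisker_nbhd[OF coordinate_loops[OF r(1) that] V(2) x[OF that]] .
    ultimately have "openin ?Q (\<Pi>\<^sub>E j\<in>J. ?N j)"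
      by (simp add: openin_PiE_gen)
    moreover have "pi1_product_map J X x a \<in> (\<Pi>\<^sub>E j\<in>J. ?N j)"
      using whisker_nbhd_self[OF coordinate_loops[OF r(1)] x]
      by (auto simp: r(2) pi1_product_map_loop_class[OF r(1)])
    moreover have "(\<Pi>\<^sub>E j\<in>J. ?N j) \<subseteq> pi1_product_map J X x ` W"
      using box_whisker_subset_image[OF r(1), of V] whisker_nbhd_mono[OF V(4), of ?P ?b r] U(3)
      by blast
    ultimately show "\<exists>T. openin ?Q T \<and> pi1_product_map J X x a \<in> T \<and> T \<subseteq> pi1_product_map J X x ` W"
      by blast
  qed
qed

theorem proposition3p8:
  fixes J :: "'i set" and X :: "'i \<Rightarrow> 'a topology" and x :: "'i \<Rightarrow> 'a"
  assumes "\<And>i. i \<in> J \<Longrightarrow> x i \<in> topspace (X i)"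
    and "\<And>i. i \<in> J \<Longrightarrow> path_connected_space (X i)"
    and "\<And>i. i \<in> J \<Longrightarrow> locally_path_connected_space (X i)"
  defines "P \<equiv> product_topology X J" and "b \<equiv> (\<lambda>i\<in>J. x i)"
    and "\<Phi> \<equiv> pi1_product_map J X x"
  shows "(\<forall>\<zeta> \<in> loops P b.
            \<Phi> (loop_class P b \<zeta>) = (\<lambda>j\<in>J. loop_class (X j) (x j) ((\<lambda>z. z j) \<circ> \<zeta>)))
       \<and> \<Phi> \<in> iso (fundamental_group P b) (product_group J (\<lambda>i. fundamental_group (X i) (x i)))
       \<and> homeomorphic_map (whisker_topology P b)
            (product_topology (\<lambda>i. whisker_topology (X i) (x i)) J) \<Phi>"
proof (intro conjI ballI)
  show "homeomorphic_map (whisker_topology P b)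
          (product_topology (\<lambda>i. whisker_topology (X i) (x i)) J) \<Phi>"
    unfolding P_def b_def \<Phi>_def
    using pi1_product_map_bij[of J X x]
    by (intro bijective_open_imp_homeomorphic_map continuous_map_pi1_product_map
        open_map_pi1_product_map) (auto simp: bij_betw_def)
qed (simp_all add: P_def b_def \<Phi>_def pi1_product_map_loop_class pi1_product_map_iso)

end
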